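(* Let $\mu$ be a compactly supported Borel probability measure on $\mathbb{R}$. For $\delta>0$ let $\gamma_\delta$ be the Gaussian measure centered at $0$ with variance $\delta$, i.e. $d\gamma_\delta(t)=\frac{1}{\sqrt{2\pi\delta}}\exp\left(\frac{-t^2}{2\delta}\right)dt$. Then for every $\delta>0$ the convolution $\mu*\gamma_\delta$ satisfies a logarithmic Sobolev inequality with constant $c$ for some $c=c(\delta)\in\mathbb{R}$.
   Context: A probability measure $\nu$ on $\mathbb{R}^n$ satisfies a logarithmic Sobolev inequality (LSI) with constant $c\in\mathbb{R}$ if $\mathrm{Ent}_\nu(g^2)\leq 2c\int|\nabla g|^2\,d\nu$ for all smooth and sufficiently integrable functions $g:\mathbb{R}^n\to\mathbb{R}$ (meaning: $g$ is $C^\infty$ and $g^2$, $g^2\log g^2$ and $|\nabla g|^2$ are $\nu$-integrable), where for measurable $f\geq 0$, $\mathrm{Ent}_\nu(f)=\int f\log f\,d\nu-\int f\,d\nu\,\log\int f\,d\nu$, with the convention $0\log 0=0$. Here $n=1$. *)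

theory Defs
  imports "HOL-Probability.Probability"
begin

definition msupport :: "'a::topological_space measure \<Rightarrow> 'a set" where
  "msupport M = {x. \<forall>U. open U \<and> x \<in> U \<longrightarrow> emeasure M U > 0}"

definition compactly_supported :: "'a::topological_space measure \<Rightarrow> bool" where
  "compactly_supported M \<longleftrightarrow> compact (msupport M)"

lemma closed_msupport: "closed (msupport M)"
proof -
  have "- msupport M = \<Union>{U. open U \<and> emeasure M U = 0}"
    unfolding msupport_def by (auto simp: zero_less_iff_neq_zero)
  then have "open (- msupport M)"
    by auto
  then show ?thesis
    by (simp add: closed_def)
qed

lemma emeasure_Compl_msupport:
  fixes M :: "'a::second_countable_topology measure"
  assumes "sets M = sets borel"
  shows "emeasure M (- msupport M) = 0"
proof -
  have eq: "- msupport M = \<Union>{U. open U \<and> emeasure M U = 0}"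
    unfolding msupport_def by (auto simp: zero_less_iff_neq_zero)
  obtain \<U> where \<U>: "\<U> \<subseteq> {U. open U \<and> emeasure M U = 0}" "countable \<U>"
    "\<Union>\<U> = \<Union>{U. open U \<and> emeasure M U = 0}"
    using Lindelof[of "{U. open U \<and> emeasure M U = 0}"] by auto
  have "(\<Union>U\<in>\<U>. U) \<in> null_sets M"
    using \<U> assms by (intro null_sets_UN' null_setsI) auto
  then show ?thesis
    using eq \<U>(3) by (simp add: null_setsD1)
qed

lemma compactly_supported_iff:
  fixes M :: "'a::{second_countable_topology, t2_space} measure"
  assumes "sets M = sets borel"
  shows "compactly_supported M \<longleftrightarrow> (\<exists>K. compact K \<and> emeasure M (- K) = 0)"
proof
  assume "compactly_supported M"
  then show "\<exists>K. compact K \<and> emeasure M (- K) = 0"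
    using emeasure_Compl_msupport[OF assms] unfolding compactly_supported_def by blast
next
  assume "\<exists>K. compact K \<and> emeasure M (- K) = 0"
  then obtain K where K: "compact K" "emeasure M (- K) = 0"
    by blast
  have "open (- K)"
    using K(1) compact_imp_closed by auto
  then have "msupport M \<subseteq> K"
    using K(2) unfolding msupport_def by force
  then show "compactly_supported M"
    using K(1) closed_msupport[of M] compact_Int_closed[of K "msupport M"]
    unfolding compactly_supported_def by (simp add: inf.absorb2)
qed

definition gaussian_measure :: "real \<Rightarrow> real measure" where
  "gaussian_measure \<delta> = density lborel (normal_density 0 (sqrt \<delta>))"

text \<open>\<^const>\<open>normal_density\<close> takes the standard deviation, hence the square root above.\<close>

lemma gaussian_measure_eq:
  assumes "\<delta> > 0"
  shows "gaussian_measure \<delta> =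
    density lborel (\<lambda>t. ennreal (1 / sqrt (2 * pi * \<delta>) * exp (- t\<^sup>2 / (2 * \<delta>))))"
  using assms unfolding gaussian_measure_def normal_density_def by simp

definition smooth :: "(real \<Rightarrow> real) \<Rightarrow> bool" where
  "smooth g \<longleftrightarrow> (\<forall>k. (deriv ^^ k) g differentiable_on UNIV)"

text \<open>The convention \<open>0 log 0 = 0\<close> is automatic because \<open>0 * ln 0 = 0\<close>.\<close>

definition Ent :: "'a measure \<Rightarrow> ('a \<Rightarrow> real) \<Rightarrow> real" where
  "Ent \<nu> f = (\<integral>x. f x * ln (f x) \<partial>\<nu>) - (\<integral>x. f x \<partial>\<nu>) * ln (\<integral>x. f x \<partial>\<nu>)"

definition satisfies_LSI :: "real measure \<Rightarrow> real \<Rightarrow> bool" where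
  "satisfies_LSI \<nu> c \<longleftrightarrow>
    (\<forall>g. smooth g
       \<and> integrable \<nu> (\<lambda>x. (g x)\<^sup>2)
       \<and> integrable \<nu> (\<lambda>x. (g x)\<^sup>2 * ln ((g x)\<^sup>2))
       \<and> integrable \<nu> (\<lambda>x. \<bar>deriv g x\<bar>\<^sup>2)
      \<longrightarrow> Ent \<nu> (\<lambda>x. (g x)\<^sup>2) \<le> 2 * c * (\<integral>x. \<bar>deriv g x\<bar>\<^sup>2 \<partial>\<nu>))"

end

theory Submission
  imports Defs
begin

text \<open>
  Write \<open>\<nu> = \<mu> \<star> \<gamma>\<^sub>\<delta>\<close>, let \<open>R\<close> bound the support of \<open>\<mu>\<close>, and for smooth \<open>g\<close> put
  \<open>G = g - g(0)\<close> and \<open>E = \<integral>(g')\<^sup>2 d\<nu>\<close>. The proof rests on two facts.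

  The first is a weighted Hardy inequality. For \<open>\<bar>t\<bar> \<le> R\<close> let \<open>q\<close> be the Gaussian density with
  mean \<open>t\<close> and variance \<open>\<delta>\<close>. Multiplying \<open>q\<close> by \<open>u(x) = (1 + x) exp(\<lambda> / (1 + x))\<close> with
  \<open>\<lambda>\<close> large enough in terms of \<open>\<delta>\<close> and \<open>R\<close> produces a function that decreases on
  \<open>[0, \<infinity>)\<close> at relative rate at least \<open>(1 + x) / (2\<delta>)\<close>, wherever the mean \<open>t\<close> lies.
  Integrating the derivative of \<open>G\<^sup>2 u q\<close> from \<open>0\<close>, where \<open>G\<close> vanishes, and completing a square
  gives both an integrated bound, \<open>\<integral>(1 + x\<^sup>2) G\<^sup>2 q \<le> const \<cdot> \<integral>(g')\<^sup>2 q\<close>, and, from the boundary term,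
  a pointwise bound, \<open>G(x)\<^sup>2 q(x) \<le> const \<cdot> \<integral>(g')\<^sup>2 q\<close> (\<open>gaussian_hardy\<close>). The base point
  \<open>0\<close> and the constants do not depend on \<open>t\<close> and both bounds are linear in the measure, so they
  may be averaged over \<open>\<mu>(dt)\<close>. The result is \<open>\<integral>(1 + x\<^sup>2) G\<^sup>2 d\<nu> \<le> const \<cdot> E\<close>
  (\<open>convolution_hardy\<close>) and \<open>G(x)\<^sup>2 \<le> E exp(A (1 + x\<^sup>2))\<close>
  (\<open>convolution_pointwise_growth\<close>).

  The second is that \<open>Ent(f) \<le> \<integral>(f log(f/a) - f + a) d\<nu>\<close> for every constant \<open>a > 0\<close>
  (\<open>Ent_le_integral\<close>). Take \<open>f = g\<^sup>2\<close> and \<open>a = g(0)\<^sup>2 + E\<close>. The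
  integrand vanishes to second order at \<open>f = a\<close>, which bounds it by a multiple of \<open>G\<^sup>2 + E\<close> where
  \<open>\<bar>G\<bar> \<le> \<bar>g(0)\<bar>\<close>; elsewhere \<open>f \<le> 4 G\<^sup>2\<close>, and the
  pointwise bound on \<open>G\<close> makes the logarithm at most of order \<open>1 + x\<^sup>2\<close>. In both cases the integrand
  is at most \<open>const \<cdot> (1 + x\<^sup>2) G\<^sup>2 + 2E\<close> (\<open>entropy_integrand_le\<close>), which integrates to at most
  \<open>const \<cdot> E\<close> by the integrated Hardy bound.
\<close>

section \<open>A Hardy inequality for Gaussian weights\<close>

text \<open>
  The parameter \<open>\<lambda>\<close> of the factor \<open>exp(\<lambda> / (1 + x))\<close>. With \<open>B = (R + 1) / \<delta> + 1\<close> it is an upper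
  bound for \<open>y\<^sup>2 (B - y / (2\<delta>))\<close> over \<open>y \<ge> 1\<close>, which is what the next lemma requires.
\<close>

definition hardy_exponent :: "real \<Rightarrow> real \<Rightarrow> real" where
  "hardy_exponent \<delta> R = 4 * \<delta>\<^sup>2 * ((R + 1) / \<delta> + 1) ^ 3"

text \<open>
  The left-hand side is the logarithmic derivative of \<open>(1 + x) exp(\<lambda> / (1 + x)) q(x)\<close> for the Gaussian
  density \<open>q\<close> with mean \<open>t\<close>. Far out the Gaussian alone forces the decay; on the remaining
  bounded interval, where \<open>q\<close> may still increase, the term with \<open>\<lambda>\<close> does.
\<close>

lemma hardy_weight_decay:
  fixes \<delta> R t x :: real
  assumes "\<delta> > 0" "\<bar>t\<bar> \<le> R" "x \<ge> 0"
  shows "1 / (1 + x) - hardy_exponent \<delta> R / (1 + x)\<^sup>2 - (x - t) / \<delta> \<le> - ((1 + x) / (2 * \<delta>))"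
proof -
  define y where "y = 1 + x"
  define B where "B = (R + 1) / \<delta> + 1"
  have y: "y \<ge> 1" and R: "R \<ge> 0" using assms by (auto simp: y_def)
  have B: "B > 0" using R assms(1) by (simp add: B_def add_nonneg_pos)
  have *: "y\<^sup>2 * (B - y / (2 * \<delta>)) \<le> 4 * \<delta>\<^sup>2 * B ^ 3"
  proof (cases "y \<le> 2 * \<delta> * B")
    case True
    have "y\<^sup>2 * (B - y / (2 * \<delta>)) \<le> y\<^sup>2 * B"
      using y assms(1) by (intro mult_left_mono) auto
    also have "\<dots> \<le> (2 * \<delta> * B)\<^sup>2 * B"
      using True y B by (intro mult_right_mono power_mono) auto
    also have "\<dots> = 4 * \<delta>\<^sup>2 * B ^ 3"
      by (simp add: power2_eq_square power3_eq_cube)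
    finally show ?thesis .
  next
    case False
    then have "B - y / (2 * \<delta>) \<le> 0"
      using assms(1) by (simp add: field_simps)
    then have "y\<^sup>2 * (B - y / (2 * \<delta>)) \<le> 0"
      by (simp add: mult_nonneg_nonpos)
    also have "0 \<le> 4 * \<delta>\<^sup>2 * B ^ 3" using B by simp
    finally show ?thesis .
  qed
  have "B - y / (2 * \<delta>) \<le> hardy_exponent \<delta> R / y\<^sup>2"
    using * y by (simp add: hardy_exponent_def B_def pos_le_divide_eq mult.commute)
  moreover have "1 / y \<le> 1" using y by simp
  moreover have "(x - t) / \<delta> \<ge> (y - (R + 1)) / \<delta>"
    using assms by (intro divide_right_mono) (auto simp: y_def)
  moreover have "(y - (R + 1)) / \<delta> = 2 * (y / (2 * \<delta>)) - (B - 1)"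
    using assms(1) by (simp add: B_def field_simps)
  ultimately have "1 / y - hardy_exponent \<delta> R / y\<^sup>2 - (x - t) / \<delta> \<le> - (y / (2 * \<delta>))"
    by linarith
  then show ?thesis by (simp add: y_def)
qed

lemma has_real_derivative_normal_density:
  fixes \<delta> t x :: real
  assumes "\<delta> > 0"
  shows "(normal_density t (sqrt \<delta>) has_real_derivative
           - ((x - t) / \<delta>) * normal_density t (sqrt \<delta>) x) (at x)"
proof -
  define c where "c = 1 / sqrt (2 * pi * \<delta>)"
  have eq: "normal_density t (sqrt \<delta>) = (\<lambda>x. c * exp (- (x - t)\<^sup>2 / (2 * \<delta>)))"
    using assms by (auto simp: normal_density_def c_def)
  have "((\<lambda>x. c * exp (- (x - t)\<^sup>2 / (2 * \<delta>))) has_real_derivative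
          - ((x - t) / \<delta>) * (c * exp (- (x - t)\<^sup>2 / (2 * \<delta>)))) (at x)"
    using assms by (auto intro!: derivative_eq_intros) (simp add: field_simps)
  then show ?thesis by (simp add: eq)
qed

text \<open>
  Integrate the derivative of \<open>G\<^sup>2 u q\<close> over \<open>[0, N]\<close>. Since the boundary term at \<open>N\<close> is kept and
  not just discarded by its sign, one integration bounds \<open>G\<close> both at the point \<open>N\<close> and on average.
\<close>

lemma gaussian_hardy_interval:
  fixes G G' :: "real \<Rightarrow> real" and \<delta> R t N :: real
  assumes "\<delta> > 0" "\<bar>t\<bar> \<le> R" "N \<ge> 0" and "G 0 = 0"
    and G: "\<And>x. (G has_real_derivative G' x) (at x)" and "continuous_on UNIV G'"
  defines "q \<equiv> normal_density t (sqrt \<delta>)"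
  shows "(G N)\<^sup>2 * q N + (1 / (4 * \<delta>)) * integral {0..N} (\<lambda>x. (1 + x\<^sup>2) * (G x)\<^sup>2 * q x)
           \<le> 4 * \<delta> * exp (hardy_exponent \<delta> R) * integral {0..N} (\<lambda>x. (G' x)\<^sup>2 * q x)"
proof -
  define l where "l = hardy_exponent \<delta> R"
  define u where "u = (\<lambda>x. (1 + x) * exp (l / (1 + x)))"
  have R: "R \<ge> 0" using assms by auto
  have l: "l \<ge> 0" using assms R by (simp add: l_def hardy_exponent_def)
  have q_pos: "q x > 0" for x
    using assms(1) by (simp add: q_def normal_density_pos)
  have dq: "(q has_real_derivative - ((x - t) / \<delta>) * q x) (at x)" for x
    unfolding q_def by (rule has_real_derivative_normal_density[OF assms(1)])
  have cG: "continuous_on S G" for S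
    using G by (meson DERIV_isCont continuous_at_imp_continuous_on)
  have cq: "continuous_on S q" for S
    using dq by (meson DERIV_isCont continuous_at_imp_continuous_on)
  have cG': "continuous_on S G'" for S
    using assms(6) continuous_on_subset by blast
  define D where "D = (\<lambda>x. 2 * G x * G' x * (u x * q x)
     + (G x)\<^sup>2 * (u x * q x * (1 / (1 + x) - l / (1 + x)\<^sup>2 - (x - t) / \<delta>)))"
  have du: "(u has_real_derivative u x * (1 / (1 + x) - l / (1 + x)\<^sup>2)) (at x)" if "x \<ge> 0" for x
  proof -
    have nz: "1 + x \<noteq> 0" using that by simp
    have "(u has_real_derivative 1 * exp (l / (1 + x)) + exp (l / (1 + x)) * (- l / (1 + x)\<^sup>2) * (1 + x)) (at x)"
      unfolding u_def using nz by (auto intro!: derivative_eq_intros simp: power2_eq_square)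
    also have "1 * exp (l / (1 + x)) + exp (l / (1 + x)) * (- l / (1 + x)\<^sup>2) * (1 + x)
        = u x * (1 / (1 + x) - l / (1 + x)\<^sup>2)"
      using nz by (simp add: u_def right_diff_distrib)
    finally show ?thesis .
  qed
  have "((\<lambda>x. (G x)\<^sup>2 * (u x * q x)) has_real_derivative D x) (at x)" if "x \<ge> 0" for x
    using that by (auto intro!: derivative_eq_intros G dq du simp: D_def algebra_simps)
  then have "(D has_integral ((G N)\<^sup>2 * (u N * q N) - (G 0)\<^sup>2 * (u 0 * q 0))) {0..N}"
    using assms(3) by (intro fundamental_theorem_of_calculus)
      (auto simp: has_real_derivative_iff_has_vector_derivative[symmetric] intro: has_field_derivative_at_within)
  then have D_int: "(D has_integral ((G N)\<^sup>2 * (u N * q N))) {0..N}"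
    using assms(4) by simp
  have int1: "(\<lambda>x. (1 + x\<^sup>2) * (G x)\<^sup>2 * q x) integrable_on {0..N}"
    by (intro integrable_continuous_real continuous_intros cG cq)
  have int2: "(\<lambda>x. (G' x)\<^sup>2 * q x) integrable_on {0..N}"
    by (intro integrable_continuous_real continuous_intros cG' cq)
  have D_le: "D x \<le> 4 * \<delta> * exp l * ((G' x)\<^sup>2 * q x) - (1 / (4 * \<delta>)) * ((1 + x\<^sup>2) * (G x)\<^sup>2 * q x)"
    if x: "x \<in> {0..N}" for x
  proof -
    define y where "y = 1 + x"
    have y: "y \<ge> 1" using x by (simp add: y_def)
    have u_y: "u x = y * exp (l / y)" by (simp add: u_def y_def)
    then have u0: "u x > 0" using y by simp
    have e: "exp (l / y) \<le> exp l" "1 \<le> exp (l / y)"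
      using y l by (auto simp: divide_le_eq mult_left_mono[of 1 y l, simplified])
    have "D x \<le> 2 * G x * G' x * (u x * q x) + (G x)\<^sup>2 * (u x * q x * (- (y / (2 * \<delta>))))"
      unfolding D_def y_def l_def using hardy_weight_decay[OF assms(1,2), of x] x u0 q_pos[of x]
      by (intro add_left_mono mult_left_mono) auto
    also have "\<dots> = (u x * q x) * (2 * G x * G' x - (y / (2 * \<delta>)) * (G x)\<^sup>2)"
      by (simp add: algebra_simps)
    also have "\<dots> \<le> (u x * q x) * ((4 * \<delta> / y) * (G' x)\<^sup>2 - (y / (4 * \<delta>)) * (G x)\<^sup>2)"
    proof (intro mult_left_mono)
      \<comment> \<open>The square is weighted so that half of the decay term absorbs the mixed term.\<close>
      have "0 \<le> (y / (4 * \<delta>)) * (G x - (4 * \<delta> / y) * G' x)\<^sup>2"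
        using y assms(1) by simp
      also have "\<dots> = (y / (4 * \<delta>)) * (G x)\<^sup>2 - 2 * G x * G' x + (4 * \<delta> / y) * (G' x)\<^sup>2"
        using y assms(1) by (simp add: power2_eq_square field_simps)
      finally show "2 * G x * G' x - (y / (2 * \<delta>)) * (G x)\<^sup>2
          \<le> (4 * \<delta> / y) * (G' x)\<^sup>2 - (y / (4 * \<delta>)) * (G x)\<^sup>2"
        by (simp add: field_simps)
    qed (use u0 q_pos[of x] in simp)
    also have "\<dots> = 4 * \<delta> * exp (l / y) * ((G' x)\<^sup>2 * q x) - (1 / (4 * \<delta>)) * ((y\<^sup>2 * exp (l / y)) * (G x)\<^sup>2 * q x)"
      using y by (simp add: u_y field_simps power2_eq_square)
    also have "\<dots> \<le> 4 * \<delta> * exp l * ((G' x)\<^sup>2 * q x) - (1 / (4 * \<delta>)) * ((1 + x\<^sup>2) * (G x)\<^sup>2 * q x)"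
    proof (intro diff_mono mult_left_mono mult_right_mono)
      have "1 + x\<^sup>2 \<le> y\<^sup>2 * 1" using x by (simp add: y_def power2_eq_square algebra_simps)
      also have "\<dots> \<le> y\<^sup>2 * exp (l / y)" using e by (intro mult_left_mono) auto
      finally show "1 + x\<^sup>2 \<le> y\<^sup>2 * exp (l / y)" .
    qed (use e assms(1) q_pos[of x] in auto)
    finally show ?thesis .
  qed
  have "(G N)\<^sup>2 * (u N * q N) \<le> 4 * \<delta> * exp l * integral {0..N} (\<lambda>x. (G' x)\<^sup>2 * q x)
        - (1 / (4 * \<delta>)) * integral {0..N} (\<lambda>x. (1 + x\<^sup>2) * (G x)\<^sup>2 * q x)"
    by (rule has_integral_le[OF D_int _ D_le])
      (intro has_integral_diff has_integral_mult_right integrable_integral int1 int2)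
  moreover have "(G N)\<^sup>2 * q N \<le> (G N)\<^sup>2 * (u N * q N)"
  proof -
    have "1 * 1 \<le> (1 + N) * exp (l / (1 + N))"
      using assms(3) l by (intro mult_mono) auto
    then have "1 * q N \<le> u N * q N"
      using q_pos[of N] by (intro mult_right_mono) (auto simp: u_def)
    then show ?thesis by (intro mult_left_mono) auto
  qed
  ultimately show ?thesis by (simp add: l_def)
qed


lemma nn_integral_Icc_continuous:
  fixes f :: "real \<Rightarrow> real"
  assumes "continuous_on UNIV f" "\<And>x. 0 \<le> f x"
  shows "(\<integral>\<^sup>+x. ennreal (f x) * indicator {a..b} x \<partial>lborel) = ennreal (integral {a..b} f)"
  using assms continuous_on_subset[OF assms(1), of "{a..b}"]
  by (intro nn_integral_has_integral_lebesgue' integrable_integral integrable_continuous_real) auto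

lemma nn_integral_atLeast_le:
  fixes f :: "real \<Rightarrow> real"
  assumes cont: "continuous_on UNIV f" and nonneg: "\<And>x. 0 \<le> f x"
    and le: "\<And>n::nat. ennreal (integral {0..real n} f) \<le> B"
  shows "(\<integral>\<^sup>+x. ennreal (f x) * indicator {0..} x \<partial>lborel) \<le> B"
proof -
  let ?F = "\<lambda>(n::nat) x. ennreal (f x) * indicator {0..real n} x"
  have [measurable]: "f \<in> borel_measurable borel"
    using cont by (rule borel_measurable_continuous_onI)
  have inc: "incseq ?F"
    by (auto simp: incseq_def le_fun_def split: split_indicator)
  have "(SUP n. ?F n x) = ennreal (f x) * indicator {0..} x" for x
  proof (rule antisym)
    obtain n :: nat where "x \<le> real n" using real_arch_simple by blast
    then have "ennreal (f x) * indicator {0..} x \<le> ?F n x"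
      by (auto split: split_indicator)
    then show "ennreal (f x) * indicator {0..} x \<le> (SUP n. ?F n x)"
      by (meson SUP_upper2 UNIV_I)
  qed (auto intro!: SUP_least split: split_indicator)
  then have "(\<integral>\<^sup>+x. ennreal (f x) * indicator {0..} x \<partial>lborel) = (\<integral>\<^sup>+x. (SUP n. ?F n x) \<partial>lborel)"
    by simp
  also have "\<dots> = (SUP n. \<integral>\<^sup>+x. ?F n x \<partial>lborel)"
    by (rule nn_integral_monotone_convergence_SUP[OF inc]) simp
  also have "\<dots> \<le> B"
    using le by (auto intro!: SUP_least simp: nn_integral_Icc_continuous[OF cont nonneg])
  finally show ?thesis .
qed

lemma gaussian_hardy_half_line:
  fixes G G' :: "real \<Rightarrow> real" and \<delta> R t :: real
  assumes "\<delta> > 0" "\<bar>t\<bar> \<le> R" and "G 0 = 0"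
    and G: "\<And>x. (G has_real_derivative G' x) (at x)" and G': "continuous_on UNIV G'"
  defines "q \<equiv> normal_density t (sqrt \<delta>)"
  defines "I \<equiv> \<integral>\<^sup>+x. ennreal ((G' x)\<^sup>2 * q x) \<partial>lborel"
  shows "(\<integral>\<^sup>+x. ennreal ((1 + x\<^sup>2) * (G x)\<^sup>2 * q x) * indicator {0..} x \<partial>lborel)
           \<le> ennreal (16 * \<delta>\<^sup>2 * exp (hardy_exponent \<delta> R)) * I" (is ?integrated)
    and "x \<ge> 0 \<Longrightarrow> ennreal ((G x)\<^sup>2 * q x) \<le> ennreal (4 * \<delta> * exp (hardy_exponent \<delta> R)) * I"
proof -
  define l where "l = hardy_exponent \<delta> R"
  have q0: "q x \<ge> 0" for x by (simp add: q_def)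
  have cq: "continuous_on UNIV q"
    unfolding q_def normal_density_def using assms(1) by (intro continuous_intros) auto
  have cG: "continuous_on UNIV G"
    using G by (meson DERIV_isCont continuous_at_imp_continuous_on)
  define J where "J N = integral {0..N} (\<lambda>x. (G' x)\<^sup>2 * q x)" for N
  define H where "H N = integral {0..N} (\<lambda>x. (1 + x\<^sup>2) * (G x)\<^sup>2 * q x)" for N
  have J: "ennreal (J N) \<le> I" for N
  proof -
    have "ennreal (J N) = (\<integral>\<^sup>+x. ennreal ((G' x)\<^sup>2 * q x) * indicator {0..N} x \<partial>lborel)"
      unfolding J_def using q0
      by (intro nn_integral_Icc_continuous[symmetric] continuous_intros G' cq) auto
    also have "\<dots> \<le> I"
      unfolding I_def by (intro nn_integral_mono) (auto split: split_indicator)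
    finally show ?thesis .
  qed
  have bound: "(G N)\<^sup>2 * q N + (1 / (4 * \<delta>)) * H N \<le> 4 * \<delta> * exp l * J N" if "N \<ge> 0" for N
    unfolding H_def J_def l_def q_def
    by (rule gaussian_hardy_interval[OF assms(1,2) that assms(3) G G'])
  have H0: "H N \<ge> 0" for N unfolding H_def
    using q0 by (intro integral_nonneg integrable_continuous_real continuous_intros
        continuous_on_subset[OF cG] continuous_on_subset[OF cq]) auto
  have scale: "ennreal y \<le> ennreal k * I" if "y \<le> k * J N" "k \<ge> 0" for y k N
  proof -
    have "ennreal y \<le> ennreal (k * J N)" using that by (intro ennreal_leI)
    also have "\<dots> = ennreal k * ennreal (J N)"
      using that by (simp add: ennreal_mult')
    also have "\<dots> \<le> ennreal k * I" by (intro mult_left_mono J) auto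
    finally show ?thesis .
  qed
  show ?integrated
  proof (rule nn_integral_atLeast_le)
    fix n :: nat
    have "(1 / (4 * \<delta>)) * H n \<le> 4 * \<delta> * exp l * J n"
    proof -
      have "0 \<le> (G n)\<^sup>2 * q n" using q0 by simp
      then show ?thesis using bound[of n] by linarith
    qed
    then have "H n \<le> 16 * \<delta>\<^sup>2 * exp l * J n"
      using assms(1) by (simp add: field_simps power2_eq_square)
    then show "ennreal (integral {0..real n} (\<lambda>x. (1 + x\<^sup>2) * (G x)\<^sup>2 * q x))
        \<le> ennreal (16 * \<delta>\<^sup>2 * exp (hardy_exponent \<delta> R)) * I"
      using scale by (simp add: H_def l_def)
  qed (use q0 in \<open>auto intro!: continuous_intros cG cq\<close>)
  show "ennreal ((G x)\<^sup>2 * q x) \<le> ennreal (4 * \<delta> * exp (hardy_exponent \<delta> R)) * I" if "x \<ge> 0"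
  proof -
    have "0 \<le> 1 / (4 * \<delta>) * H x" using assms(1) H0 by simp
    then have "(G x)\<^sup>2 * q x \<le> 4 * \<delta> * exp l * J x" using bound[OF that] by linarith
    then show ?thesis using scale assms(1) by (simp add: l_def)
  qed
qed

text \<open>
  Reflection at the origin exchanges \<open>t\<close> and \<open>- t\<close>, which the hypothesis on \<open>t\<close> allows, so the
  half-line bounds also hold on the left. Each half is estimated by the energy on the whole line, which
  doubles the constant.
\<close>

lemma gaussian_hardy:
  fixes G G' :: "real \<Rightarrow> real" and \<delta> R t :: real
  assumes "\<delta> > 0" "\<bar>t\<bar> \<le> R" and "G 0 = 0"
    and G: "\<And>x. (G has_real_derivative G' x) (at x)" and G': "continuous_on UNIV G'"
  defines "q \<equiv> normal_density t (sqrt \<delta>)"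
  defines "I \<equiv> \<integral>\<^sup>+x. ennreal ((G' x)\<^sup>2 * q x) \<partial>lborel"
  shows "(\<integral>\<^sup>+x. ennreal ((1 + x\<^sup>2) * (G x)\<^sup>2 * q x) \<partial>lborel)
           \<le> ennreal (32 * \<delta>\<^sup>2 * exp (hardy_exponent \<delta> R)) * I" (is ?integrated)
    and "ennreal ((G x)\<^sup>2 * q x) \<le> ennreal (4 * \<delta> * exp (hardy_exponent \<delta> R)) * I" (is ?pointwise)
proof -
  define r where "r = normal_density (- t) (sqrt \<delta>)"
  have r: "r x = q (- x)" for x
  proof -
    have "(x + t)\<^sup>2 = (- x - t)\<^sup>2" by (simp add: power2_eq_square algebra_simps)
    then show ?thesis by (simp add: r_def q_def normal_density_def)
  qed
  have [measurable]: "G \<in> borel_measurable borel" "G' \<in> borel_measurable borel"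
    "q \<in> borel_measurable borel"
    using G G' by (auto simp: q_def intro!: borel_measurable_continuous_onI
        intro: DERIV_isCont continuous_at_imp_continuous_on)
  have reflect: "(\<integral>\<^sup>+x. f (- x) \<partial>lborel) = (\<integral>\<^sup>+x. f x \<partial>lborel)"
    if "f \<in> borel_measurable borel" for f :: "real \<Rightarrow> ennreal"
    using nn_integral_real_affine[OF that, of "-1" 0] by simp
  have dR: "((\<lambda>x. G (- x)) has_real_derivative - G' (- x)) (at x)" for x
    using DERIV_chain2[OF G DERIV_minus[OF DERIV_ident], of "x" UNIV] by simp
  have cR: "continuous_on UNIV (\<lambda>x. - G' (- x))"
    by (intro continuous_intros continuous_on_compose2[OF G']) auto
  have I_reflect: "(\<integral>\<^sup>+x. ennreal ((- G' (- x))\<^sup>2 * r x) \<partial>lborel) = I"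
    unfolding I_def r using reflect[of "\<lambda>x. ennreal ((G' x)\<^sup>2 * q x)"] by simp
  note pos = gaussian_hardy_half_line[OF assms(1-3) G G', folded q_def, folded I_def]
  note neg = gaussian_hardy_half_line[where t = "- t", OF assms(1) _ _ dR cR, of R,
      folded r_def, unfolded I_reflect]
  let ?f = "\<lambda>x. ennreal ((1 + x\<^sup>2) * (G x)\<^sup>2 * q x)"
  have "(\<integral>\<^sup>+x. ?f x * indicator {0..} (- x) \<partial>lborel)
      = (\<integral>\<^sup>+x. ?f (- x) * indicator {0..} x \<partial>lborel)"
    using reflect[of "\<lambda>x. ?f (- x) * indicator {0..} x"] by simp
  also have "\<dots> \<le> ennreal (16 * \<delta>\<^sup>2 * exp (hardy_exponent \<delta> R)) * I"
    using neg(1) assms(2,3) by (simp add: r)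
  finally have neg_int: "(\<integral>\<^sup>+x. ?f x * indicator {0..} (- x) \<partial>lborel)
      \<le> ennreal (16 * \<delta>\<^sup>2 * exp (hardy_exponent \<delta> R)) * I" .
  have "(\<integral>\<^sup>+x. ?f x \<partial>lborel)
      \<le> (\<integral>\<^sup>+x. ?f x * indicator {0..} x + ?f x * indicator {0..} (- x) \<partial>lborel)"
    by (intro nn_integral_mono) (auto split: split_indicator)
  also have "\<dots> = (\<integral>\<^sup>+x. ?f x * indicator {0..} x \<partial>lborel) + (\<integral>\<^sup>+x. ?f x * indicator {0..} (- x) \<partial>lborel)"
    by (rule nn_integral_add) auto
  also have "\<dots> \<le> ennreal (16 * \<delta>\<^sup>2 * exp (hardy_exponent \<delta> R)) * I
      + ennreal (16 * \<delta>\<^sup>2 * exp (hardy_exponent \<delta> R)) * I"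
    by (intro add_mono pos(1) neg_int)
  also have "\<dots> = ennreal (32 * \<delta>\<^sup>2 * exp (hardy_exponent \<delta> R)) * I"
    by (simp add: distrib_right[symmetric] ennreal_plus[symmetric] del: ennreal_plus)
  finally show ?integrated .
  show ?pointwise
  proof (cases "x \<ge> 0")
    case True
    then show ?thesis by (rule pos(2))
  next
    case False
    then show ?thesis using neg(2)[of "- x"] assms(2,3) by (simp add: r)
  qed
qed

section \<open>Averaging over the centres\<close>

text \<open>
  \<open>\<mu> \<star> \<gamma>\<^sub>\<delta>\<close> is the mixture, over its centres \<open>t\<close> distributed as \<open>\<mu>\<close>, of the Gaussians with
  mean \<open>t\<close>. This transfers to it every estimate that is uniform in \<open>t\<close> and linear in the measure.
\<close>

lemma nn_integral_convolution_gaussian: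
  assumes "prob_space \<mu>" "sets \<mu> = sets borel" "\<delta> > 0" and [measurable]: "f \<in> borel_measurable borel"
  shows "(\<integral>\<^sup>+x. f x \<partial>(\<mu> \<star> gaussian_measure \<delta>))
       = (\<integral>\<^sup>+t. (\<integral>\<^sup>+x. ennreal (normal_density t (sqrt \<delta>) x) * f x \<partial>lborel) \<partial>\<mu>)"
proof -
  have inner: "(\<integral>\<^sup>+y. f (t + y) \<partial>gaussian_measure \<delta>)
      = (\<integral>\<^sup>+x. ennreal (normal_density t (sqrt \<delta>) x) * f x \<partial>lborel)" for t
  proof -
    have "(\<integral>\<^sup>+x. ennreal (normal_density t (sqrt \<delta>) x) * f x \<partial>lborel)
        = (\<integral>\<^sup>+y. ennreal (normal_density t (sqrt \<delta>) (t + y)) * f (t + y) \<partial>lborel)"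
      using nn_integral_real_affine[of "\<lambda>x. ennreal (normal_density t (sqrt \<delta>) x) * f x" 1 t] by simp
    also have "\<dots> = (\<integral>\<^sup>+y. f (t + y) \<partial>gaussian_measure \<delta>)"
      by (simp add: gaussian_measure_def nn_integral_density normal_density_def)
    finally show ?thesis by simp
  qed
  have "prob_space (gaussian_measure \<delta>)"
    using assms(3) by (simp add: gaussian_measure_def prob_space_normal_density)
  then show ?thesis
    unfolding inner[symmetric] using assms
    by (intro nn_integral_convolution) (auto simp: prob_space_def gaussian_measure_def)
qed

lemma borel_measurable_nn_integral_normal_density:
  assumes [measurable_cong]: "sets \<mu> = sets borel" and [measurable]: "f \<in> borel_measurable borel"
  shows "(\<lambda>t. \<integral>\<^sup>+x. ennreal (normal_density t \<sigma> x) * f x \<partial>lborel) \<in> borel_measurable \<mu>"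
  unfolding normal_density_def by measurable


text \<open>
  The three summands absorb, in this order, the factor \<open>exp \<lambda>\<close> of the pointwise Hardy bound, its other
  constant together with the normalisation of the Gaussian (through \<open>c \<le> exp c\<close>), and the
  reciprocal of the exponential in the lower bound \<open>normal_density_ge\<close>.
\<close>

definition growth_exponent :: "real \<Rightarrow> real \<Rightarrow> real" where
  "growth_exponent \<delta> R = hardy_exponent \<delta> R + 4 * \<delta> * sqrt (2 * pi * \<delta>) + (1 + R\<^sup>2) / \<delta>"

lemma normal_density_ge:
  assumes "\<delta> > 0" "\<bar>t\<bar> \<le> R"
  shows "exp (- (x\<^sup>2 + R\<^sup>2) / \<delta>) / sqrt (2 * pi * \<delta>) \<le> normal_density t (sqrt \<delta>) x"
proof -
  have "t\<^sup>2 \<le> R\<^sup>2" using assms(2) by (metis abs_ge_zero power2_abs power_mono)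
  moreover have "(x - t)\<^sup>2 \<le> 2 * x\<^sup>2 + 2 * t\<^sup>2"
    using zero_le_power2[of "x + t"] by (simp add: power2_eq_square algebra_simps)
  ultimately have "(x - t)\<^sup>2 / (2 * \<delta>) \<le> (2 * (x\<^sup>2 + R\<^sup>2)) / (2 * \<delta>)"
    using assms(1) by (intro divide_right_mono) auto
  also have "\<dots> = (x\<^sup>2 + R\<^sup>2) / \<delta>" using assms(1) by (simp add: field_simps)
  finally have "- (x\<^sup>2 + R\<^sup>2) / \<delta> \<le> - (x - t)\<^sup>2 / (2 * \<delta>)"
    by (simp only: minus_divide_left[symmetric] neg_le_iff_le)
  then have "exp (- (x\<^sup>2 + R\<^sup>2) / \<delta>) \<le> exp (- (x - t)\<^sup>2 / (2 * \<delta>))"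
    by (simp only: exp_le_cancel_iff)
  then show ?thesis
    using assms(1) by (simp add: normal_density_def divide_right_mono)
qed

context
  fixes \<mu> :: "real measure" and \<delta> R :: real and G G' :: "real \<Rightarrow> real"
  assumes \<mu>: "prob_space \<mu>" "sets \<mu> = sets borel" and R: "AE t in \<mu>. \<bar>t\<bar> \<le> R"
    and \<delta>: "\<delta> > 0"
    and G0: "G 0 = 0" and G: "\<And>x. (G has_real_derivative G' x) (at x)"
    and G': "continuous_on UNIV G'"
begin

lemma measurable_G: "G \<in> borel_measurable borel" "G' \<in> borel_measurable borel"
  using G G' by (auto intro!: borel_measurable_continuous_onI
        intro: DERIV_isCont continuous_at_imp_continuous_on)

lemma energy_mixture:
  "(\<integral>\<^sup>+t. \<integral>\<^sup>+x. ennreal ((G' x)\<^sup>2 * normal_density t (sqrt \<delta>) x) \<partial>lborel \<partial>\<mu>)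
     = (\<integral>\<^sup>+x. ennreal ((G' x)\<^sup>2) \<partial>(\<mu> \<star> gaussian_measure \<delta>))"
  and measurable_energy: 
  "(\<lambda>t. \<integral>\<^sup>+x. ennreal ((G' x)\<^sup>2 * normal_density t (sqrt \<delta>) x) \<partial>lborel) \<in> borel_measurable \<mu>"
proof -
  note [measurable] = measurable_G
  have eq: "ennreal ((G' x)\<^sup>2 * normal_density t (sqrt \<delta>) x)
      = ennreal (normal_density t (sqrt \<delta>) x) * ennreal ((G' x)\<^sup>2)" for t x
    by (simp add: ennreal_mult' mult.commute)
  show "(\<integral>\<^sup>+t. \<integral>\<^sup>+x. ennreal ((G' x)\<^sup>2 * normal_density t (sqrt \<delta>) x) \<partial>lborel \<partial>\<mu>)
     = (\<integral>\<^sup>+x. ennreal ((G' x)\<^sup>2) \<partial>(\<mu> \<star> gaussian_measure \<delta>))"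
    unfolding eq by (rule nn_integral_convolution_gaussian[OF \<mu> \<delta>, symmetric]) simp
  show "(\<lambda>t. \<integral>\<^sup>+x. ennreal ((G' x)\<^sup>2 * normal_density t (sqrt \<delta>) x) \<partial>lborel) \<in> borel_measurable \<mu>"
    unfolding eq by (rule borel_measurable_nn_integral_normal_density[OF \<mu>(2)]) simp
qed

lemma convolution_hardy:
  "(\<integral>\<^sup>+x. ennreal ((1 + x\<^sup>2) * (G x)\<^sup>2) \<partial>(\<mu> \<star> gaussian_measure \<delta>))
     \<le> ennreal (32 * \<delta>\<^sup>2 * exp (hardy_exponent \<delta> R))
        * (\<integral>\<^sup>+x. ennreal ((G' x)\<^sup>2) \<partial>(\<mu> \<star> gaussian_measure \<delta>))"
proof -
  note [measurable] = measurable_G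
  let ?K = "ennreal (32 * \<delta>\<^sup>2 * exp (hardy_exponent \<delta> R))"
  have "(\<integral>\<^sup>+x. ennreal ((1 + x\<^sup>2) * (G x)\<^sup>2) \<partial>(\<mu> \<star> gaussian_measure \<delta>))
      = (\<integral>\<^sup>+t. \<integral>\<^sup>+x. ennreal (normal_density t (sqrt \<delta>) x) * ennreal ((1 + x\<^sup>2) * (G x)\<^sup>2) \<partial>lborel \<partial>\<mu>)"
    by (rule nn_integral_convolution_gaussian[OF \<mu> \<delta>]) simp
  also have "\<dots> = (\<integral>\<^sup>+t. \<integral>\<^sup>+x. ennreal ((1 + x\<^sup>2) * (G x)\<^sup>2 * normal_density t (sqrt \<delta>) x) \<partial>lborel \<partial>\<mu>)"
    by (intro nn_integral_cong) (subst mult.commute, simp add: ennreal_mult'')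
  also have "\<dots> \<le> (\<integral>\<^sup>+t. ?K * (\<integral>\<^sup>+x. ennreal ((G' x)\<^sup>2 * normal_density t (sqrt \<delta>) x) \<partial>lborel) \<partial>\<mu>)"
    using R by (intro nn_integral_mono_AE) (auto intro: gaussian_hardy(1)[OF \<delta> _ G0 G G'])
  also have "\<dots> = ?K * (\<integral>\<^sup>+x. ennreal ((G' x)\<^sup>2) \<partial>(\<mu> \<star> gaussian_measure \<delta>))"
    by (simp add: nn_integral_cmult measurable_energy energy_mixture)
  finally show ?thesis .
qed

text \<open>
  The left-hand side does not depend on the centre \<open>t\<close>. After \<open>q(x)\<close> is replaced by a lower bound
  that is uniform in \<open>t\<close>, averaging the pointwise Hardy bound over \<open>t\<close> changes only its right-hand side.
\<close>

lemma convolution_pointwise_growth: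
  "ennreal ((G x)\<^sup>2) \<le> ennreal (exp (growth_exponent \<delta> R * (1 + x\<^sup>2)))
      * (\<integral>\<^sup>+x. ennreal ((G' x)\<^sup>2) \<partial>(\<mu> \<star> gaussian_measure \<delta>))"
proof -
  interpret prob_space \<mu> by (rule \<mu>(1))
  define E where "E = (\<integral>\<^sup>+x. ennreal ((G' x)\<^sup>2) \<partial>(\<mu> \<star> gaussian_measure \<delta>))"
  define l where "l = hardy_exponent \<delta> R"
  define \<kappa> where "\<kappa> = exp (- (x\<^sup>2 + R\<^sup>2) / \<delta>) / sqrt (2 * pi * \<delta>)"
  let ?I = "\<lambda>t. \<integral>\<^sup>+x. ennreal ((G' x)\<^sup>2 * normal_density t (sqrt \<delta>) x) \<partial>lborel"
  have "AE t in \<mu>. R \<ge> 0" using R by eventually_elim auto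
  then have R0: "R \<ge> 0" by simp
  have "\<kappa> > 0" using \<delta> by (simp add: \<kappa>_def)
  have "AE t in \<mu>. ennreal ((G x)\<^sup>2 * \<kappa>) \<le> ennreal (4 * \<delta> * exp l) * ?I t"
    using R
  proof eventually_elim
    case (elim t)
    have "ennreal ((G x)\<^sup>2 * \<kappa>) \<le> ennreal ((G x)\<^sup>2 * normal_density t (sqrt \<delta>) x)"
      unfolding \<kappa>_def using normal_density_ge[OF \<delta> elim] by (intro ennreal_leI mult_left_mono) auto
    also have "\<dots> \<le> ennreal (4 * \<delta> * exp l) * ?I t"
      unfolding l_def by (rule gaussian_hardy(2)[OF \<delta> elim G0 G G'])
    finally show ?case .
  qed
  then have "(\<integral>\<^sup>+t. ennreal ((G x)\<^sup>2 * \<kappa>) \<partial>\<mu>) \<le> (\<integral>\<^sup>+t. ennreal (4 * \<delta> * exp l) * ?I t \<partial>\<mu>)"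
    by (rule nn_integral_mono_AE)
  then have le: "ennreal ((G x)\<^sup>2 * \<kappa>) \<le> ennreal (4 * \<delta> * exp l) * E"
    by (simp add: emeasure_space_1 nn_integral_cmult measurable_energy energy_mixture E_def)
  have l0: "l \<ge> 0" using \<delta> R0 by (simp add: l_def hardy_exponent_def)
  have const: "4 * \<delta> * exp l / \<kappa> \<le> exp (growth_exponent \<delta> R * (1 + x\<^sup>2))"
  proof -
    have "4 * \<delta> * exp l / \<kappa> = (4 * \<delta> * sqrt (2 * pi * \<delta>)) * exp l * exp ((x\<^sup>2 + R\<^sup>2) / \<delta>)"
    proof -
      have "exp (- (x\<^sup>2 + R\<^sup>2) / \<delta>) = inverse (exp ((x\<^sup>2 + R\<^sup>2) / \<delta>))"
        unfolding minus_divide_left[symmetric] by (rule exp_minus)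
      then show ?thesis by (simp add: \<kappa>_def divide_inverse)
    qed
    also have "\<dots> \<le> exp (4 * \<delta> * sqrt (2 * pi * \<delta>)) * exp l * exp ((x\<^sup>2 + R\<^sup>2) / \<delta>)"
    proof (intro mult_right_mono)
      show "4 * \<delta> * sqrt (2 * pi * \<delta>) \<le> exp (4 * \<delta> * sqrt (2 * pi * \<delta>))"
        using exp_ge_add_one_self[of "4 * \<delta> * sqrt (2 * pi * \<delta>)"] by linarith
    qed auto
    also have "\<dots> = exp (4 * \<delta> * sqrt (2 * pi * \<delta>) + l + (x\<^sup>2 + R\<^sup>2) / \<delta>)"
      by (simp add: exp_add)
    also have "\<dots> \<le> exp (growth_exponent \<delta> R * (1 + x\<^sup>2))"
    proof -
      have "(x\<^sup>2 + R\<^sup>2) / \<delta> \<le> ((1 + R\<^sup>2) * (1 + x\<^sup>2)) / \<delta>"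
        using \<delta> by (intro divide_right_mono) (auto simp: algebra_simps)
      moreover have "(1 + R\<^sup>2) * (1 + x\<^sup>2) / \<delta> = (1 + R\<^sup>2) / \<delta> * (1 + x\<^sup>2)" by simp
      moreover have "4 * \<delta> * sqrt (2 * pi * \<delta>) + l \<le> (4 * \<delta> * sqrt (2 * pi * \<delta>) + l) * (1 + x\<^sup>2)"
        using \<delta> l0 by (subst distrib_left) simp
      ultimately have "4 * \<delta> * sqrt (2 * pi * \<delta>) + l + (x\<^sup>2 + R\<^sup>2) / \<delta>
          \<le> (4 * \<delta> * sqrt (2 * pi * \<delta>) + l) * (1 + x\<^sup>2) + (1 + R\<^sup>2) / \<delta> * (1 + x\<^sup>2)"
        by linarith
      also have "\<dots> = growth_exponent \<delta> R * (1 + x\<^sup>2)"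
        by (simp only: growth_exponent_def l_def distrib_right[symmetric] add.commute add.left_commute)
      finally show ?thesis by simp
    qed
    finally show ?thesis .
  qed
  have "ennreal ((G x)\<^sup>2) = ennreal (1 / \<kappa>) * ennreal ((G x)\<^sup>2 * \<kappa>)"
    using \<open>\<kappa> > 0\<close> by (simp add: ennreal_mult'[symmetric])
  also have "\<dots> \<le> ennreal (1 / \<kappa>) * (ennreal (4 * \<delta> * exp l) * E)"
    by (intro mult_left_mono le) auto
  also have "\<dots> = ennreal (4 * \<delta> * exp l / \<kappa>) * E"
    using \<open>\<kappa> > 0\<close> \<delta> by (simp add: mult.assoc[symmetric] ennreal_mult'[symmetric])
  also have "\<dots> \<le> ennreal (exp (growth_exponent \<delta> R * (1 + x\<^sup>2))) * E"
    by (intro mult_right_mono ennreal_leI const) auto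
  finally show ?thesis by (simp add: E_def)
qed

end

section \<open>From the Hardy inequality to the entropy\<close>

text \<open>
  With \<open>f = (b + G)\<^sup>2\<close> and \<open>a = b\<^sup>2 + E\<close>, the function \<open>f log(f/a) - f + a\<close> is at most
  \<open>(f - a)\<^sup>2 / a\<close>. If \<open>\<bar>G\<bar> \<le> \<bar>b\<bar>\<close>, then \<open>f - a\<close> is of order \<open>\<bar>b\<bar> \<bar>G\<bar> + E\<close>, and dividing by
  \<open>a \<ge> b\<^sup>2\<close> and \<open>a \<ge> E\<close> removes \<open>b\<close>. If \<open>\<bar>G\<bar> > \<bar>b\<bar>\<close>, then \<open>f \<le> 4 G\<^sup>2\<close> and
  \<open>f / a \<le> 4 G\<^sup>2 / E \<le> 4 exp L\<close>. The summand \<open>E\<close> in \<open>a\<close> serves the second case, where \<open>b\<close>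
  may be arbitrarily small.
\<close>

lemma entropy_integrand_le:
  fixes b G E L :: real
  assumes E: "E > 0" and L: "L \<ge> 0" and G: "G\<^sup>2 \<le> E * exp L"
  shows "(b + G)\<^sup>2 * ln ((b + G)\<^sup>2 / (b\<^sup>2 + E)) - (b + G)\<^sup>2 + (b\<^sup>2 + E) \<le> (18 + 4 * L) * G\<^sup>2 + 2 * E"
proof -
  define a where "a = b\<^sup>2 + E"
  define f where "f = (b + G)\<^sup>2"
  have a: "a > 0" "E \<le> a" "b\<^sup>2 \<le> a" using E by (auto simp: a_def add_nonneg_pos)
  have f0: "f \<ge> 0" by (simp add: f_def)
  have LG: "0 \<le> L * G\<^sup>2" using L by simp
  have "f * ln (f / a) - f + a \<le> (18 + 4 * L) * G\<^sup>2 + 2 * E"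
  proof (cases "\<bar>G\<bar> \<le> \<bar>b\<bar>")
    case True
    have "f * ln (f / a) \<le> f * (f / a - 1)"
      using a f0 by (cases "f = 0") (auto intro!: mult_left_mono ln_le_minus_one)
    then have "f * ln (f / a) - f + a \<le> (f - a)\<^sup>2 / a"
      using a by (simp add: power2_eq_square field_simps)
    also have "\<dots> \<le> (18 * (G\<^sup>2 * b\<^sup>2) + 2 * (E * E)) / a"
    proof (intro divide_right_mono)
      have "f - a = G * (2 * b + G) - E" by (simp add: f_def a_def power2_eq_square algebra_simps)
      moreover have "(w - E)\<^sup>2 \<le> 2 * w\<^sup>2 + 2 * E\<^sup>2" for w
        using zero_le_power2[of "w + E"] by (simp add: power2_eq_square algebra_simps)
      ultimately have "(f - a)\<^sup>2 \<le> 2 * (G * (2 * b + G))\<^sup>2 + 2 * E\<^sup>2"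
        by simp
      moreover have "(2 * b + G)\<^sup>2 \<le> (3 * b)\<^sup>2"
        using True by (intro abs_le_square_iff[THEN iffD1]) auto
      then have "G\<^sup>2 * (2 * b + G)\<^sup>2 \<le> G\<^sup>2 * (3 * b)\<^sup>2" by (intro mult_left_mono) auto
      then have "(G * (2 * b + G))\<^sup>2 \<le> 9 * (G\<^sup>2 * b\<^sup>2)"
        by (simp add: power_mult_distrib mult_ac)
      ultimately show "(f - a)\<^sup>2 \<le> 18 * (G\<^sup>2 * b\<^sup>2) + 2 * (E * E)"
        unfolding power2_eq_square[of E] by linarith
    qed (use a in simp)
    also have "\<dots> \<le> (18 * (G\<^sup>2 * a) + 2 * (E * a)) / a"
      using a E by (intro divide_right_mono add_mono mult_left_mono) auto
    also have "\<dots> = 18 * G\<^sup>2 + 2 * E" using a by (simp add: field_simps)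
    also have "\<dots> \<le> (18 + 4 * L) * G\<^sup>2 + 2 * E" using LG by (simp add: distrib_right)
    finally show ?thesis .
  next
    case False
    have b: "b\<^sup>2 \<le> G\<^sup>2" using False by (simp add: abs_le_square_iff[symmetric])
    have "\<bar>b + G\<bar> \<le> \<bar>2 * G\<bar>" using False by auto
    then have f4: "f \<le> 4 * G\<^sup>2"
      unfolding f_def by (subst (asm) abs_le_square_iff) (simp add: power_mult_distrib)
    show ?thesis
    proof (cases "f \<le> a")
      case True
      then have "f * ln (f / a) \<le> 0"
        using a f0 by (cases "f = 0") (auto intro!: mult_nonneg_nonpos ln_le_zero_iff[THEN iffD2])
      then have "f * ln (f / a) - f + a \<le> G\<^sup>2 + E" using f0 b by (simp add: a_def)
      also have "\<dots> \<le> (18 + 4 * L) * G\<^sup>2 + 2 * E" using LG E by (simp add: distrib_right)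
      finally show ?thesis .
    next
      case fa: False
      have "f / a \<le> 4 * (E * exp L) / E"
        using f4 G a E f0 by (intro frac_le) auto
      then have "f / a \<le> 4 * exp L" using E by simp
      then have "ln (f / a) \<le> ln (4 * exp L)" using fa a by (intro ln_mono) auto
      also have "\<dots> = ln 4 + L" by (simp add: ln_mult)
      also have "\<dots> \<le> 3 + L" using ln_le_minus_one[of 4] by simp
      finally have "f * ln (f / a) \<le> (4 * G\<^sup>2) * (3 + L)"
        using f4 f0 fa a by (intro mult_mono) auto
      then have "f * ln (f / a) - f + a \<le> 12 * G\<^sup>2 + 4 * (L * G\<^sup>2)"
        using fa by (simp add: algebra_simps)
      also have "\<dots> \<le> (18 + 4 * L) * G\<^sup>2 + 2 * E" using E by (simp add: distrib_right)
      finally show ?thesis .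
    qed
  qed
  then show ?thesis by (simp add: f_def a_def)
qed

text \<open>
  With \<open>m = \<integral>f\<close>, the integral of \<open>f log(f/a) - f + a\<close> exceeds the entropy by
  \<open>m log(m/a) - m + a\<close>, which is nonnegative since \<open>log s \<le> s - 1\<close>.
\<close>

lemma (in prob_space) Ent_le_integral:
  fixes f h :: "'a \<Rightarrow> real"
  assumes f: "integrable M f" "\<And>x. 0 \<le> f x" "integrable M (\<lambda>x. f x * ln (f x))"
    and h: "integrable M h" and a: "a > 0"
    and le: "\<And>x. f x * ln (f x / a) - f x + a \<le> h x"
  shows "Ent M f \<le> (\<integral>x. h x \<partial>M)"
proof -
  define m where "m = (\<integral>x. f x \<partial>M)"
  have m0: "m \<ge> 0" unfolding m_def using f by simp
  have "m * ln (a / m) \<le> m * (a / m - 1)"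
    using m0 a by (cases "m = 0") (auto intro!: mult_left_mono ln_le_minus_one)
  then have tangent: "m * ln a - m * ln m \<le> a - m"
    using m0 a by (cases "m = 0") (auto simp: ln_div algebra_simps)
  have "f x * ln (f x) - f x * ln a - f x + a \<le> h x" for x
    using le[of x] f(2)[of x] a by (cases "f x = 0") (auto simp: ln_div algebra_simps)
  then have "(\<integral>x. f x * ln (f x) - f x * ln a - f x + a \<partial>M) \<le> (\<integral>x. h x \<partial>M)"
    using f h by (intro integral_mono) auto
  also have "(\<integral>x. f x * ln (f x) - f x * ln a - f x + a \<partial>M)
      = (\<integral>x. f x * ln (f x) \<partial>M) - m * ln a - m + a"
    using f by (simp add: m_def prob_space)
  finally show ?thesis using tangent by (simp add: Ent_def m_def[symmetric])
qed

section \<open>The logarithmic Sobolev inequality\<close>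

lemma compactly_supported_AE_bounded:
  assumes "sets \<mu> = sets borel" "compactly_supported (\<mu> :: real measure)"
  obtains R where "AE t in \<mu>. \<bar>t\<bar> \<le> R"
proof -
  obtain K where K: "compact K" "emeasure \<mu> (- K) = 0"
    using assms compactly_supported_iff by blast
  obtain R where "\<And>t. t \<in> K \<Longrightarrow> \<bar>t\<bar> \<le> R"
    using compact_imp_bounded[OF K(1)] by (auto simp: bounded_iff)
  moreover have "- K \<in> null_sets \<mu>"
    using K assms(1) borel_open[OF open_Compl[OF compact_imp_closed[OF K(1)]]]
    by (intro null_setsI) auto
  then have "AE t in \<mu>. t \<in> K" using AE_not_in by fastforce
  ultimately have "AE t in \<mu>. \<bar>t\<bar> \<le> R" by (auto elim: eventually_mono)
  then show ?thesis by (rule that)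
qed

lemma convolution_gaussian_LSI:
  fixes \<mu> :: "real measure" and \<delta> R :: real
  assumes \<mu>: "prob_space \<mu>" "sets \<mu> = sets borel" and R: "AE t in \<mu>. \<bar>t\<bar> \<le> R" and \<delta>: "\<delta> > 0"
  shows "satisfies_LSI (\<mu> \<star> gaussian_measure \<delta>)
           (1 + (18 + 4 * growth_exponent \<delta> R) * (16 * \<delta>\<^sup>2 * exp (hardy_exponent \<delta> R)))"
    (is "satisfies_LSI ?\<nu> ?c")
  unfolding satisfies_LSI_def
proof (intro allI impI, elim conjE)
  fix g :: "real \<Rightarrow> real"
  assume "smooth g" and int_sq: "integrable ?\<nu> (\<lambda>x. (g x)\<^sup>2)"
    and int_ln: "integrable ?\<nu> (\<lambda>x. (g x)\<^sup>2 * ln ((g x)\<^sup>2))"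
    and "integrable ?\<nu> (\<lambda>x. \<bar>deriv g x\<bar>\<^sup>2)"
  then have int_deriv: "integrable ?\<nu> (\<lambda>x. (deriv g x)\<^sup>2)" by simp
  interpret \<mu>: prob_space \<mu> by (rule \<mu>(1))
  interpret \<gamma>: prob_space "gaussian_measure \<delta>"
    using \<delta> by (simp add: gaussian_measure_def prob_space_normal_density)
  interpret P: pair_prob_space \<mu> "gaussian_measure \<delta>" ..
  interpret \<nu>: prob_space ?\<nu>
    unfolding convolution_def using \<mu>(2)
    by (intro P.prob_space_distr) (auto simp: gaussian_measure_def cong: measurable_cong_sets)
  define K where "K = 32 * \<delta>\<^sup>2 * exp (hardy_exponent \<delta> R)"
  define A where "A = growth_exponent \<delta> R"
  define b where "b = g 0"
  define G where "G = (\<lambda>x. g x - b)"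
  define E where "E = (\<integral>x. (deriv g x)\<^sup>2 \<partial>?\<nu>)"
  have "AE t in \<mu>. R \<ge> 0" using R by eventually_elim auto
  then have R0: "R \<ge> 0" by simp
  have A0: "A \<ge> 0" and K0: "K \<ge> 0"
    using \<delta> R0 by (auto simp: A_def K_def growth_exponent_def hardy_exponent_def)
  have E0: "E \<ge> 0" by (simp add: E_def)
  have E_nn: "(\<integral>\<^sup>+x. ennreal ((deriv g x)\<^sup>2) \<partial>?\<nu>) = ennreal E"
    unfolding E_def by (intro nn_integral_eq_integral int_deriv) auto
  have dg: "g differentiable_on UNIV" "deriv g differentiable_on UNIV"
    using \<open>smooth g\<close> by (auto simp: smooth_def dest: spec[of _ 0] spec[of _ 1])
  have dG: "(G has_real_derivative deriv g x) (at x)" for x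
  proof -
    have "g differentiable (at x)" using dg(1) by (simp add: differentiable_on_def)
    then have "(g has_real_derivative deriv g x) (at x)"
      using DERIV_deriv_iff_real_differentiable by blast
    then show ?thesis unfolding G_def by (auto intro!: derivative_eq_intros)
  qed
  have cg': "continuous_on UNIV (deriv g)"
    using dg(2) by (rule differentiable_imp_continuous_on)
  have G0: "G 0 = 0" by (simp add: G_def b_def)
  note hyps = \<mu> R \<delta> G0 dG cg'
  have [measurable]: "G \<in> borel_measurable borel" using measurable_G(1)[OF hyps] .
  have hardy: "(\<integral>\<^sup>+x. ennreal ((1 + x\<^sup>2) * (G x)\<^sup>2) \<partial>?\<nu>) \<le> ennreal (K * E)"
    using convolution_hardy[OF hyps] K0 by (simp add: E_nn K_def ennreal_mult')
  have int_G: "integrable ?\<nu> (\<lambda>x. (1 + x\<^sup>2) * (G x)\<^sup>2)"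
    using hardy by (intro integrableI_bounded) (auto simp: abs_mult order_le_less_trans)
  have hardy_real: "(\<integral>x. (1 + x\<^sup>2) * (G x)\<^sup>2 \<partial>?\<nu>) \<le> K * E"
    using hardy nn_integral_eq_integral[OF int_G] K0 E0 by simp
  have growth: "(G x)\<^sup>2 \<le> E * exp (A * (1 + x\<^sup>2))" for x
    using convolution_pointwise_growth[OF hyps, of x] E0
    by (simp add: E_nn A_def ennreal_mult'[symmetric] mult.commute)
  \<comment> \<open>The entropy estimate divides by the energy, which vanishes for constant \<open>g\<close>; hence the
    slack \<open>e\<close>.\<close>
  have "Ent ?\<nu> (\<lambda>x. (g x)\<^sup>2) \<le> 2 * ?c * E + e" if "e > 0" for e
  proof -
    define E' where "E' = E + e / 2"
    define h where "h = (\<lambda>x. (18 + 4 * A) * ((1 + x\<^sup>2) * (G x)\<^sup>2) + 2 * E')"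
    have E': "E' > 0" "E \<le> E'" using that E0 by (auto simp: E'_def)
    have "Ent ?\<nu> (\<lambda>x. (g x)\<^sup>2) \<le> (\<integral>x. h x \<partial>?\<nu>)"
    proof (rule \<nu>.Ent_le_integral[OF int_sq _ int_ln])
      show "integrable ?\<nu> h" unfolding h_def using int_G by simp
      show "b\<^sup>2 + E' > 0" using E' by (simp add: add_nonneg_pos)
      fix x
      have "(G x)\<^sup>2 \<le> E' * exp (A * (1 + x\<^sup>2))"
        using growth[of x] E' by (meson exp_ge_zero mult_right_mono order_trans)
      then have "(b + G x)\<^sup>2 * ln ((b + G x)\<^sup>2 / (b\<^sup>2 + E')) - (b + G x)\<^sup>2 + (b\<^sup>2 + E')
          \<le> (18 + 4 * (A * (1 + x\<^sup>2))) * (G x)\<^sup>2 + 2 * E'"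
        using E' A0 by (intro entropy_integrand_le) auto
      also have "\<dots> \<le> h x" by (simp add: h_def algebra_simps)
      finally show "(g x)\<^sup>2 * ln ((g x)\<^sup>2 / (b\<^sup>2 + E')) - (g x)\<^sup>2 + (b\<^sup>2 + E') \<le> h x"
        by (simp add: G_def)
    qed simp
    also have "\<dots> = (18 + 4 * A) * (\<integral>x. (1 + x\<^sup>2) * (G x)\<^sup>2 \<partial>?\<nu>) + 2 * E'"
      unfolding h_def using int_G by (simp add: \<nu>.prob_space[simplified])
    also have "\<dots> \<le> (18 + 4 * A) * (K * E) + 2 * E'"
      using A0 by (intro add_right_mono mult_left_mono hardy_real) auto
    also have "\<dots> = 2 * ?c * E + e"
      by (simp add: E'_def K_def A_def algebra_simps)
    finally show ?thesis .
  qed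
  then have "Ent ?\<nu> (\<lambda>x. (g x)\<^sup>2) \<le> 2 * ?c * E" by (rule field_le_epsilon)
  then show "Ent ?\<nu> (\<lambda>x. (g x)\<^sup>2) \<le> 2 * ?c * (\<integral>x. \<bar>deriv g x\<bar>\<^sup>2 \<partial>?\<nu>)"
    by (simp add: E_def)
qed

theorem theorem2:
  fixes \<mu> :: "real measure"
  assumes "prob_space \<mu>" and "sets \<mu> = sets borel"
    and "compactly_supported \<mu>"
  shows "\<forall>\<delta>>0. \<exists>c. satisfies_LSI (\<mu> \<star> gaussian_measure \<delta>) c"
proof (intro allI impI)
  fix \<delta> :: real assume "\<delta> > 0"
  obtain R where "AE t in \<mu>. \<bar>t\<bar> \<le> R"
    using compactly_supported_AE_bounded[OF assms(2,3)] .
  then show "\<exists>c. satisfies_LSI (\<mu> \<star> gaussian_measure \<delta>) c"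
    using convolution_gaussian_LSI[OF assms(1,2) _ \<open>\<delta> > 0\<close>] by blast
qed

end
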